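(* Let $(G,\mu)$ be a measured group, let $(Z,m)$ denote the Poisson boundary of $(G,\mu)$ and let $(X,\check\nu)$ be an ergodic $(G,\check\mu)$-space. Then the diagonal action $G\curvearrowright (Z\times X, m\otimes\check\nu)$, $g(z,x)=(gz,gx)$, is ergodic.
   Context: A measured group is a pair $(G,\mu)$, where $G$ is a countable group and $\mu$ is a probability measure on $G$ whose support generates $G$ as a semi-group. The adjoint measure is $\check\mu(s)=\mu(s^{-1})$. All $G$-spaces are Borel probability measure spaces $(X,\nu)$ equipped with an action of $G$ by measurable maps with measurable inverses which preserve the class of $\nu$-null sets. The action is ergodic if every Borel set $B\subset X$ with $\nu(B\,\Delta\, gB)=0$ for all $g\in G$ is $\nu$-null or $\nu$-conull. For a probability measure $p$ on $G$, $(X,\nu)$ is a $(G,p)$-space (and $\nu$ is $p$-stationary) if $\sum_{s\in G}\big(\int_X f(sx)\,d\nu(x)\big)p(s)=\int_X f\,d\nu$ for all $f\in L^\infty(X,\nu)$. $H^\infty(G,\mu)$ is the Banach space (supremum norm) of bounded real-valued functions $u$ on $G$ satisfying $\sum_s u(gs)\mu(s)=u(g)$ for all $g\in G$. The Poisson boundary of $(G,\mu)$ is the ergodic $(G,\mu)$-space $(Z,m)$, which exists and is unique up to $G$-equivariant measurable isomorphism by a theorem of Furstenberg, such that the map $P_m:L^\infty(Z,m)\to H^\infty(G,\mu)$, $P_mf(s)=\int_Z f(sz)\,dm(z)$, is an isometric isomorphism of Banach spaces. Here $L^\infty$ denotes real-valued essentially bounded functions modulo null sets. *)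

theory Defs
  imports "HOL-Probability.Probability" "HOL-Algebra.Group_Action"
begin

text \<open>The sub-semigroup generated by a set. Neither inverses nor the unit are added.\<close>

inductive_set semigroup_generate :: "('g, 'c) monoid_scheme \<Rightarrow> 'g set \<Rightarrow> 'g set"
  for G and S where
    incl: "s \<in> S \<Longrightarrow> s \<in> semigroup_generate G S"
  | mult: "s \<in> semigroup_generate G S \<Longrightarrow> t \<in> semigroup_generate G S \<Longrightarrow>
             s \<otimes>\<^bsub>G\<^esub> t \<in> semigroup_generate G S"

locale measured_group = group G for G (structure) and \<mu> :: "'g pmf" +
  assumes countable_carrier: "countable (carrier G)"
    and set_pmf_subset: "set_pmf \<mu> \<subseteq> carrier G"
    and semigroup_generate_support: "semigroup_generate G (set_pmf \<mu>) = carrier G"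

definition adjoint_pmf :: "('g, 'c) monoid_scheme \<Rightarrow> 'g pmf \<Rightarrow> 'g pmf" where
  "adjoint_pmf G \<mu> = map_pmf (\<lambda>s. inv\<^bsub>G\<^esub> s) \<mu>"

lemma (in group) pmf_adjoint_pmf:
  assumes "set_pmf \<mu> \<subseteq> carrier G" "s \<in> carrier G"
  shows "pmf (adjoint_pmf G \<mu>) s = pmf \<mu> (inv s)"
proof -
  have "pmf (adjoint_pmf G \<mu>) s = measure (measure_pmf \<mu>) (m_inv G -` {s})"
    by (simp add: adjoint_pmf_def pmf_map)
  also have "\<dots> = measure (measure_pmf \<mu>) (m_inv G -` {s} \<inter> set_pmf \<mu>)"
    by (rule measure_Int_set_pmf[symmetric])
  also have "m_inv G -` {s} \<inter> set_pmf \<mu> = {inv s} \<inter> set_pmf \<mu>"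
    using assms by auto
  also have "measure (measure_pmf \<mu>) ({inv s} \<inter> set_pmf \<mu>) = pmf \<mu> (inv s)"
    by (simp add: measure_Int_set_pmf measure_pmf_single)
  finally show ?thesis .
qed

definition standard_borel :: "'x measure \<Rightarrow> bool" where
  "standard_borel M \<longleftrightarrow>
     (\<exists>T. topspace T = space M \<and> completely_metrizable_space T \<and> second_countable T \<and>
          sets M = sigma_sets (space M) {U. openin T U})"

text \<open>Measurability of the inverse of \<open>\<phi> g\<close> is covered by \<open>action_measurable\<close>, since that inverse
  is \<open>\<phi> (inv g)\<close>; hence also \<open>\<phi> g ` B\<close> is measurable for every measurable \<open>B\<close>.\<close>

locale G_space = group_action G "space M" \<phi> + prob_space M
  for G (structure) and M :: "'x measure" and \<phi> :: "'g \<Rightarrow> 'x \<Rightarrow> 'x" +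
  assumes standard_borel: "standard_borel M"
    and action_measurable: "g \<in> carrier G \<Longrightarrow> \<phi> g \<in> measurable M M"
    and action_null_sets:
      "g \<in> carrier G \<Longrightarrow> B \<in> sets M \<Longrightarrow> \<phi> g ` B \<in> null_sets M \<longleftrightarrow> B \<in> null_sets M"

locale ergodic_G_space = G_space +
  assumes ergodic:
    "B \<in> sets M \<Longrightarrow> (\<And>g. g \<in> carrier G \<Longrightarrow> emeasure M (sym_diff B (\<phi> g ` B)) = 0) \<Longrightarrow>
       emeasure M B = 0 \<or> emeasure M (space M - B) = 0"

text \<open>Representatives of the elements of \<open>L\<^sup>\<infinity>\<close>, and the norm of the class of \<open>f\<close>.\<close>

definition L_infinity :: "'x measure \<Rightarrow> ('x \<Rightarrow> real) set" where
  "L_infinity M = {f \<in> borel_measurable M. \<exists>C. AE x in M. \<bar>f x\<bar> \<le> C}"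

definition L_infinity_norm :: "'x measure \<Rightarrow> ('x \<Rightarrow> real) \<Rightarrow> real" where
  "L_infinity_norm M f = real_of_ereal (esssup M (\<lambda>x. ereal \<bar>f x\<bar>))"

definition stationary ::
  "('g, 'c) monoid_scheme \<Rightarrow> 'g pmf \<Rightarrow> 'x measure \<Rightarrow> ('g \<Rightarrow> 'x \<Rightarrow> 'x) \<Rightarrow> bool" where
  "stationary G p M \<phi> \<longleftrightarrow>
     (\<forall>f\<in>L_infinity M.
        (\<Sum>\<^sub>\<infinity>s\<in>carrier G. (\<integral>x. f (\<phi> s x) \<partial>M) * pmf p s) = (\<integral>x. f x \<partial>M))"

text \<open>The restriction is needed because \<^const>\<open>group_action\<close> requires each group element to act by
  an extensional function.\<close>

definition diagonal_action ::
  "'x measure \<Rightarrow> 'y measure \<Rightarrow> ('g \<Rightarrow> 'x \<Rightarrow> 'x) \<Rightarrow> ('g \<Rightarrow> 'y \<Rightarrow> 'y) \<Rightarrow> 'g \<Rightarrow> 'x \<times> 'y \<Rightarrow> 'x \<times> 'y"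
  where
  "diagonal_action M N \<phi> \<psi> g = (\<lambda>(x, y) \<in> space M \<times> space N. (\<phi> g x, \<psi> g y))"

text \<open>Functions on the group are represented by extensional functions on its carrier.\<close>

definition H_infinity :: "('g, 'c) monoid_scheme \<Rightarrow> 'g pmf \<Rightarrow> ('g \<Rightarrow> real) set" where
  "H_infinity G \<mu> =
     {u \<in> extensional (carrier G). bounded (u ` carrier G) \<and>
        (\<forall>g\<in>carrier G. (\<Sum>\<^sub>\<infinity>s\<in>carrier G. u (g \<otimes>\<^bsub>G\<^esub> s) * pmf \<mu> s) = u g)}"

definition H_infinity_norm :: "('g, 'c) monoid_scheme \<Rightarrow> ('g \<Rightarrow> real) \<Rightarrow> real" where
  "H_infinity_norm G u = (SUP g\<in>carrier G. \<bar>u g\<bar>)"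

definition poisson_transform ::
  "('g, 'c) monoid_scheme \<Rightarrow> 'z measure \<Rightarrow> ('g \<Rightarrow> 'z \<Rightarrow> 'z) \<Rightarrow> ('z \<Rightarrow> real) \<Rightarrow> 'g \<Rightarrow> real" where
  "poisson_transform G m \<phi> f = (\<lambda>s \<in> carrier G. \<integral>z. f (\<phi> s z) \<partial>m)"

text \<open>The last three assumptions say that the Poisson transform is a surjective linear isometry.
  They are stated on representatives: linearity and \<open>transform_isometric\<close> make the transform well
  defined and injective on functions modulo null sets.\<close>

locale poisson_boundary = measured_group G \<mu> + ergodic_G_space G m \<phi>
  for G (structure) and \<mu> :: "'g pmf" and m :: "'z measure" and \<phi> :: "'g \<Rightarrow> 'z \<Rightarrow> 'z" +
  assumes boundary_stationary: "stationary G \<mu> m \<phi>"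
    and transform_linear:
      "f \<in> L_infinity m \<Longrightarrow> h \<in> L_infinity m \<Longrightarrow> s \<in> carrier G \<Longrightarrow>
         poisson_transform G m \<phi> (\<lambda>z. a * f z + b * h z) s =
           a * poisson_transform G m \<phi> f s + b * poisson_transform G m \<phi> h s"
    and transform_isometric:
      "f \<in> L_infinity m \<Longrightarrow>
         H_infinity_norm G (poisson_transform G m \<phi> f) = L_infinity_norm m f"
    and transform_onto: "poisson_transform G m \<phi> ` L_infinity m = H_infinity G \<mu>"

end

theory Submission
  imports Defs
begin

text \<open>For an invariant set \<open>B\<close> let \<open>h x\<close> be the \<open>m\<close>-measure of the section \<open>B\<^sub>x\<close>. Invariance of \<open>B\<close>
  turns the Poisson transform of the indicator of \<open>B\<^sub>x\<close> into \<open>s \<mapsto> h (s\<^sup>-\<^sup>1 x)\<close>, so stationarity of \<open>m\<close>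
  makes \<open>h\<close> harmonic on \<open>X\<close> for the adjoint measure. A bounded harmonic function on a stationary space
  is invariant, hence \<open>h\<close> is a constant \<open>c\<close> by ergodicity. Thus almost every section has constant
  Poisson transform, and injectivity of the transform forces its indicator to equal \<open>c\<close> almost
  everywhere.\<close>

section \<open>Sums and integrals against a discrete probability measure\<close>

text \<open>Stationarity is defined by an unordered sum over the carrier, while the arguments below
  work with integrals against \<open>p\<close>. Boundedness makes \<open>f\<close> integrable, so
  the sum converges absolutely, and indices outside \<open>A\<close> carry no mass.\<close>

lemma infsum_mult_pmf:
  fixes f :: "'a \<Rightarrow> real"
  assumes supp: "set_pmf p \<subseteq> A" and bnd: "\<And>s. s \<in> A \<Longrightarrow> \<bar>f s\<bar> \<le> C"
  shows "(\<Sum>\<^sub>\<infinity>s\<in>A. f s * pmf p s) = measure_pmf.expectation p f"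
proof -
  let ?g = "\<lambda>s. pmf p s * f s"
  have "integrable (measure_pmf p) f"
    using supp bnd by (intro measure_pmf.integrable_const_bound[where B = C]) (auto simp: AE_measure_pmf_iff)
  then have "integrable (count_space UNIV) ?g"
    unfolding measure_pmf_eq_density by (subst (asm) integrable_density) auto
  then have "Infinite_Set_Sum.abs_summable_on ?g UNIV"
    by (simp add: abs_summable_on_def)
  then have "infsetsum ?g UNIV = infsum ?g UNIV"
    using infsetsum_infsum abs_summable_equivalent by blast
  moreover have "infsum ?g UNIV = (\<Sum>\<^sub>\<infinity>s\<in>A. f s * pmf p s)"
    using supp by (intro infsum_cong_neutral) (auto simp: mult.commute set_pmf_eq)
  ultimately show ?thesis
    by (simp add: pmf_expectation_eq_infsetsum)
qed

text \<open>Shrinking the index space to the support makes it countable, so that its counting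
  measure is sigma-finite and sums over it can be exchanged with integrals.\<close>

lemma nn_integral_measure_pmf_count_space:
  fixes f :: "'a \<Rightarrow> ennreal"
  shows "(\<integral>\<^sup>+s. f s \<partial>measure_pmf p) = (\<integral>\<^sup>+s. pmf p s * f s \<partial>count_space (set_pmf p))"
  unfolding nn_integral_measure_pmf
  by (rule nn_integral_count_space_eq) (auto simp: set_pmf_eq)

lemma borel_measurable_nn_integral_pmf:
  fixes f :: "'a \<Rightarrow> 'b \<Rightarrow> ennreal"
  assumes "\<And>s. s \<in> set_pmf p \<Longrightarrow> f s \<in> borel_measurable M"
  shows "(\<lambda>x. \<integral>\<^sup>+s. f s x \<partial>measure_pmf p) \<in> borel_measurable M"
proof -
  have "(\<lambda>(x, s). pmf p s * f s x) \<in> borel_measurable (M \<Otimes>\<^sub>M count_space (set_pmf p))"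
    by (subst measurable_pair_swap_iff, rule measurable_pair_measure_countable1) (use assms in auto)
  then show ?thesis
    unfolding nn_integral_measure_pmf_count_space
    by (intro sigma_finite_measure.borel_measurable_nn_integral
        sigma_finite_measure_count_space_countable countable_set_pmf)
qed

text \<open>Tonelli for a countable index set. Measurability is asked for on the support only,
  because \<open>\<phi> s\<close> is known to be measurable only for group elements
  \<open>s\<close>.\<close>

lemma nn_integral_pmf_swap:
  fixes f :: "'a \<Rightarrow> 'b \<Rightarrow> ennreal"
  assumes meas: "\<And>s. s \<in> set_pmf p \<Longrightarrow> f s \<in> borel_measurable M"
  shows "(\<integral>\<^sup>+x. \<integral>\<^sup>+s. f s x \<partial>measure_pmf p \<partial>M) = (\<integral>\<^sup>+s. \<integral>\<^sup>+x. f s x \<partial>M \<partial>measure_pmf p)"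
proof -
  have "(\<integral>\<^sup>+x. \<integral>\<^sup>+s. f s x \<partial>measure_pmf p \<partial>M) =
        (\<integral>\<^sup>+s. \<integral>\<^sup>+x. pmf p s * f s x \<partial>M \<partial>count_space (set_pmf p))"
    unfolding nn_integral_measure_pmf_count_space
    using meas by (intro nn_integral_count_space_nn_integral) auto
  also have "\<dots> = (\<integral>\<^sup>+s. \<integral>\<^sup>+x. f s x \<partial>M \<partial>measure_pmf p)"
    unfolding nn_integral_measure_pmf_count_space
    using meas by (intro nn_integral_cong nn_integral_cmult) auto
  finally show ?thesis .
qed

section \<open>Products of standard Borel spaces\<close>

text \<open>The witness is the product topology. Second countability is what makes its Borel sets
  coincide with the product sigma-algebra.\<close>

lemma standard_borel_pair_measure:
  assumes "standard_borel M" "standard_borel N"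
  shows "standard_borel (M \<Otimes>\<^sub>M N)"
proof -
  obtain S where S: "topspace S = space M" "completely_metrizable_space S" "second_countable S"
      "sets M = sigma_sets (space M) {U. openin S U}"
    using assms(1) unfolding standard_borel_def by blast
  obtain T where T: "topspace T = space N" "completely_metrizable_space T" "second_countable T"
      "sets N = sigma_sets (space N) {U. openin T U}"
    using assms(2) unfolding standard_borel_def by blast
  obtain A where A: "countable A" "\<forall>V\<in>A. openin S V"
      "\<forall>U x. openin S U \<and> x \<in> U \<longrightarrow> (\<exists>V\<in>A. x \<in> V \<and> V \<subseteq> U)"
    using S(3) unfolding second_countable_def by (elim exE conjE) (rule that)
  obtain B where B: "countable B" "\<forall>V\<in>B. openin T V"
      "\<forall>U x. openin T U \<and> x \<in> U \<longrightarrow> (\<exists>V\<in>B. x \<in> V \<and> V \<subseteq> U)"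
    using T(3) unfolding second_countable_def by (elim exE conjE) (rule that)
  \<comment> \<open>Rectangles of basic open sets form a countable base of the product topology.
    Every open set is then a countable union of measurable rectangles.\<close>
  define R where "R = (\<lambda>(V, W). V \<times> W) ` (A \<times> B)"
  have R: "countable R" "\<And>V. V \<in> R \<Longrightarrow> openin (prod_topology S T) V"
    using A(1,2) B(1,2) by (auto simp: R_def openin_prod_Times_iff)
  have R_base: "\<exists>V\<in>R. x \<in> V \<and> V \<subseteq> U" if U: "openin (prod_topology S T) U" "x \<in> U" for U x
  proof -
    obtain V W where VW: "openin S V" "openin T W" "fst x \<in> V" "snd x \<in> W" "V \<times> W \<subseteq> U"
      using U(1)[unfolded openin_prod_topology_alt, rule_format, of "fst x" "snd x"] U(2)
      unfolding prod.collapse by blast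
    from A(3)[rule_format, OF conjI[OF VW(1,3)]]
    obtain V' where V': "V' \<in> A" "fst x \<in> V'" "V' \<subseteq> V" by blast
    from B(3)[rule_format, OF conjI[OF VW(2,4)]]
    obtain W' where W': "W' \<in> B" "snd x \<in> W'" "W' \<subseteq> W" by blast
    show ?thesis
    proof (rule bexI, intro conjI)
      show "V' \<times> W' \<in> R"
        unfolding R_def using V' W' by (intro image_eqI[of _ _ "(V', W')"]) auto
      show "x \<in> V' \<times> W'" using V' W' by (simp add: mem_Times_iff)
      show "V' \<times> W' \<subseteq> U" using V' W' VW(5) by blast
    qed
  qed
  have sec: "second_countable (prod_topology S T)"
    unfolding second_countable_def using R R_base by (intro exI[of _ R]) blast
  let ?O = "{U. openin (prod_topology S T) U}"
  have space: "space M \<times> space N = topspace (prod_topology S T)"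
    by (simp add: S T)
  have R_sets: "V \<in> sets (M \<Otimes>\<^sub>M N)" if "V \<in> R" for V
  proof -
    have "a \<times> b \<in> sets (M \<Otimes>\<^sub>M N)" if "a \<in> A" "b \<in> B" for a b
      using that A(2) B(2) by (intro pair_measureI) (simp_all add: S(4) T(4) sigma_sets.Basic)
    with that show ?thesis by (auto simp: R_def)
  qed
  have "U \<in> sets (M \<Otimes>\<^sub>M N)" if "U \<in> ?O" for U
  proof -
    have "U = \<Union>{V \<in> R. V \<subseteq> U}"
      using R_base[of U] that by (intro equalityI subsetI) blast+
    moreover have "\<Union>{V \<in> R. V \<subseteq> U} \<in> sets (M \<Otimes>\<^sub>M N)"
      using R(1) R_sets by (intro sets.countable_Union) (auto intro: countable_subset[OF _ R(1)])
    ultimately show ?thesis by simp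
  qed
  then have "sigma_sets (space M \<times> space N) ?O \<subseteq> sets (M \<Otimes>\<^sub>M N)"
    by (intro sets.sigma_sets_subset[of _ "M \<Otimes>\<^sub>M N", unfolded space_pair_measure]) auto
  \<comment> \<open>Preimages of open sets under the projections are open cylinders, so both
    projections are measurable for the Borel sets of the product topology. Hence so is the identity
    into the product measure space, which is the inclusion sought.\<close>
  moreover have "sets (M \<Otimes>\<^sub>M N) \<subseteq> sigma_sets (space M \<times> space N) ?O"
  proof -
    let ?\<Sigma> = "sigma (space M \<times> space N) ?O"
    have sub: "?O \<subseteq> Pow (space M \<times> space N)"
      unfolding space Pow_def by (intro Collect_mono impI openin_subset)
    have subS: "{U. openin S U} \<subseteq> Pow (space M)" and subT: "{U. openin T U} \<subseteq> Pow (space N)"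
      using S(1) T(1) by (auto dest: openin_subset)
    have sM: "sets M = sets (sigma (space M) {U. openin S U})"
      using S(4) subS by simp
    have sN: "sets N = sets (sigma (space N) {U. openin T U})"
      using T(4) subT by simp
    have "fst \<in> measurable ?\<Sigma> (sigma (space M) {U. openin S U})"
    proof (rule measurable_measure_of[OF subS])
      fix U assume U: "U \<in> {U. openin S U}"
      then have eq: "fst -` U \<inter> (space M \<times> space N) = U \<times> topspace T"
        using S(1) T(1) openin_subset[of S U] by auto
      have "openin (prod_topology S T) (U \<times> topspace T)"
        using U by (simp add: openin_prod_Times_iff)
      then show "fst -` U \<inter> space ?\<Sigma> \<in> sets ?\<Sigma>"
        using sub by (simp add: eq)
    qed (auto simp: space_measure_of_conv)
    then have f: "fst \<in> measurable ?\<Sigma> M"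
      using measurable_cong_sets[OF refl sM] by blast
    have "snd \<in> measurable ?\<Sigma> (sigma (space N) {U. openin T U})"
    proof (rule measurable_measure_of[OF subT])
      fix U assume U: "U \<in> {U. openin T U}"
      then have eq: "snd -` U \<inter> (space M \<times> space N) = topspace S \<times> U"
        using S(1) T(1) openin_subset[of T U] by auto
      have "openin (prod_topology S T) (topspace S \<times> U)"
        using U by (simp add: openin_prod_Times_iff)
      then show "snd -` U \<inter> space ?\<Sigma> \<in> sets ?\<Sigma>"
        using sub by (simp add: eq)
    qed (auto simp: space_measure_of_conv)
    then have s: "snd \<in> measurable ?\<Sigma> N"
      using measurable_cong_sets[OF refl sN] by blast
    have id: "(\<lambda>x. x) \<in> measurable ?\<Sigma> (M \<Otimes>\<^sub>M N)"
      using f s by (intro measurable_pair) (auto simp: comp_def)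
    show ?thesis
    proof
      fix A assume A: "A \<in> sets (M \<Otimes>\<^sub>M N)"
      then have "A \<inter> (space M \<times> space N) = A"
        using sets.sets_into_space[OF A] by (auto simp: space_pair_measure)
      then show "A \<in> sigma_sets (space M \<times> space N) ?O"
        using measurable_sets[OF id A] sub by simp
    qed
  qed
  ultimately have "sets (M \<Otimes>\<^sub>M N) = sigma_sets (space (M \<Otimes>\<^sub>M N)) ?O"
    by (simp add: space_pair_measure)
  then show ?thesis
    unfolding standard_borel_def using sec S(1,2) T(1,2)
    by (intro exI[of _ "prod_topology S T"])
      (simp add: space_pair_measure completely_metrizable_space_prod_topology)
qed

section \<open>Group actions preserving null sets, and harmonic functions on stationary
  spaces\<close>

context group_action
begin

lemma group_G: "group G"
  using group_hom group_hom.axioms(1) by blast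

lemma act_closed: "g \<in> carrier G \<Longrightarrow> x \<in> E \<Longrightarrow> \<phi> g x \<in> E"
  using element_image by blast

lemma act_inv_left: "g \<in> carrier G \<Longrightarrow> x \<in> E \<Longrightarrow> \<phi> (inv g) (\<phi> g x) = x"
  using orbit_sym_aux by blast

lemma act_inv_right: "g \<in> carrier G \<Longrightarrow> x \<in> E \<Longrightarrow> \<phi> g (\<phi> (inv g) x) = x"
  using act_inv_left[of "inv g" x] group_G by (simp add: group.inv_closed group.inv_inv)

text \<open>Nonsingularity and ergodicity are phrased with images, measurability with preimages;
  this translates between them.\<close>

lemma act_image_eq_vimage:
  assumes "g \<in> carrier G" "B \<subseteq> E"
  shows "\<phi> g ` B = \<phi> (inv g) -` B \<inter> E"
proof
  show "\<phi> g ` B \<subseteq> \<phi> (inv g) -` B \<inter> E"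
    using assms act_inv_left act_closed by (auto simp: subset_iff)
  show "\<phi> (inv g) -` B \<inter> E \<subseteq> \<phi> g ` B"
    using assms act_inv_right by (auto intro: image_eqI[OF sym])
qed

end

context G_space
begin

lemma act_vimage_null_sets:
  assumes g: "g \<in> carrier G" and B: "B \<in> null_sets M"
  shows "\<phi> g -` B \<inter> space M \<in> null_sets M"
proof -
  have "\<phi> (inv g) ` B = \<phi> g -` B \<inter> space M"
    using act_image_eq_vimage[of "inv g" B] g B group_G sets.sets_into_space[of B M]
    by (simp add: group.inv_closed group.inv_inv null_setsD2)
  then show ?thesis
    using action_null_sets[of "inv g" B] g B group_G by (auto simp: group.inv_closed)
qed

lemma AE_act:
  assumes g: "g \<in> carrier G" and ae: "AE x in M. P x"
  shows "AE x in M. P (\<phi> g x)"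
proof -
  obtain B where "B \<in> null_sets M" "{x \<in> space M. \<not> P x} \<subseteq> B"
    using ae unfolding eventually_ae_filter by blast
  then show ?thesis
    using act_closed[OF g] by (intro AE_I'[OF act_vimage_null_sets[OF g, of B]]) auto
qed

text \<open>As \<open>M\<close> is a probability measure, the inner integrals are bounded by
  \<open>C\<close> uniformly in \<open>s\<close>, which turns the defining sum of stationarity into
  an expectation.\<close>

lemma expectation_stationary:
  fixes f :: "_ \<Rightarrow> real"
  assumes st: "stationary G p M \<phi>" and p: "set_pmf p \<subseteq> carrier G"
    and f[measurable]: "f \<in> borel_measurable M" and bnd: "\<And>x. \<bar>f x\<bar> \<le> C"
  shows "measure_pmf.expectation p (\<lambda>s. \<integral>x. f (\<phi> s x) \<partial>M) = (\<integral>x. f x \<partial>M)"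
proof -
  have "\<bar>\<integral>x. f (\<phi> s x) \<partial>M\<bar> \<le> C" if s: "s \<in> carrier G" for s
  proof -
    note action_measurable[OF s, measurable]
    have "integrable M (\<lambda>x. f (\<phi> s x))"
      using bnd by (intro integrable_const_bound[where B = C]) auto
    then have "\<bar>\<integral>x. f (\<phi> s x) \<partial>M\<bar> \<le> (\<integral>x. C \<partial>M)"
      using bnd by (intro order_trans[OF integral_abs_bound] integral_mono) auto
    then show ?thesis by (simp add: prob_space)
  qed
  then have "measure_pmf.expectation p (\<lambda>s. \<integral>x. f (\<phi> s x) \<partial>M)
      = (\<Sum>\<^sub>\<infinity>s\<in>carrier G. (\<integral>x. f (\<phi> s x) \<partial>M) * pmf p s)"
    using infsum_mult_pmf[OF p, of "\<lambda>s. \<integral>x. f (\<phi> s x) \<partial>M" C] by simp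
  also have "\<dots> = (\<integral>x. f x \<partial>M)"
    using st f bnd unfolding stationary_def L_infinity_def by blast
  finally show ?thesis .
qed

text \<open>By stationarity the second moment of \<open>h (\<phi> s x)\<close> over \<open>p \<otimes> M\<close> equals that of \<open>h\<close>, so
  harmonicity leaves nothing for the mean square of \<open>h (\<phi> s x) - h x\<close>.\<close>

lemma harmonic_imp_invariant:
  fixes h :: "_ \<Rightarrow> real"
  assumes st: "stationary G p M \<phi>" and p: "set_pmf p \<subseteq> carrier G"
    and h[measurable]: "h \<in> borel_measurable M" and bnd: "\<And>x. \<bar>h x\<bar> \<le> C"
    and harm: "AE x in M. measure_pmf.expectation p (\<lambda>s. h (\<phi> s x)) = h x"
  shows "AE x in M. \<forall>s\<in>set_pmf p. h (\<phi> s x) = h x"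
proof -
  have C: "0 \<le> C" using bnd[of undefined] by linarith
  have sq: "(h x)\<^sup>2 \<le> C\<^sup>2" for x
    using bnd[of x] C by (simp add: abs_le_square_iff[symmetric])
  have meas: "\<phi> s \<in> measurable M M" if "s \<in> set_pmf p" for s
    using that p action_measurable by blast
  \<comment> \<open>The mean square increment of \<open>h\<close> in one step from \<open>x\<close>.
    As a nonnegative integral it is subject to Tonelli, and it vanishes only if the increments
    vanish on the whole support.\<close>
  define D where "D x = (\<integral>\<^sup>+s. ennreal ((h (\<phi> s x) - h x)\<^sup>2) \<partial>measure_pmf p)" for x
  have D[measurable]: "D \<in> borel_measurable M"
    unfolding D_def
  proof (rule borel_measurable_nn_integral_pmf)
    fix s assume "s \<in> set_pmf p"
    note meas[OF this, measurable]
    show "(\<lambda>x. ennreal ((h (\<phi> s x) - h x)\<^sup>2)) \<in> borel_measurable M" by measurable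
  qed
  \<comment> \<open>Second moment equals variance plus squared mean: at a point of harmonicity the
    mean of \<open>h (\<phi> s x)\<close> is \<open>h x\<close>, so the cross term contributes
    \<open>- 2 * (h x)\<^sup>2\<close>.\<close>
  have split: "(\<integral>\<^sup>+s. ennreal ((h (\<phi> s x))\<^sup>2) \<partial>measure_pmf p) = D x + ennreal ((h x)\<^sup>2)"
    if x: "measure_pmf.expectation p (\<lambda>s. h (\<phi> s x)) = h x" for x
  proof -
    have i1: "integrable (measure_pmf p) (\<lambda>s. h (\<phi> s x))"
      using bnd by (intro measure_pmf.integrable_const_bound[where B = C]) auto
    have i2: "integrable (measure_pmf p) (\<lambda>s. (h (\<phi> s x))\<^sup>2)"
      using sq by (intro measure_pmf.integrable_const_bound[where B = "C\<^sup>2"]) auto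
    have eq: "(h (\<phi> s x) - h x)\<^sup>2 = (h (\<phi> s x))\<^sup>2 - 2 * h x * h (\<phi> s x) + (h x)\<^sup>2" for s
      by (simp add: power2_eq_square algebra_simps)
    have i3: "integrable (measure_pmf p) (\<lambda>s. (h (\<phi> s x) - h x)\<^sup>2)"
      unfolding eq using i1 i2 by simp
    have "measure_pmf.expectation p (\<lambda>s. (h (\<phi> s x))\<^sup>2)
        = measure_pmf.expectation p (\<lambda>s. (h (\<phi> s x) - h x)\<^sup>2) + (h x)\<^sup>2"
      unfolding eq using i1 i2 x by (simp add: power2_eq_square)
    then show ?thesis
      unfolding D_def using i2 i3
      by (simp add: nn_integral_eq_integral ennreal_plus)
  qed
  have "(\<integral>\<^sup>+x. D x \<partial>M) + (\<integral>\<^sup>+x. ennreal ((h x)\<^sup>2) \<partial>M)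
      = (\<integral>\<^sup>+x. D x + ennreal ((h x)\<^sup>2) \<partial>M)"
    by (simp add: nn_integral_add)
  also have "\<dots> = (\<integral>\<^sup>+x. \<integral>\<^sup>+s. ennreal ((h (\<phi> s x))\<^sup>2) \<partial>measure_pmf p \<partial>M)"
    using harm split by (intro nn_integral_cong_AE) auto
  also have "\<dots> = (\<integral>\<^sup>+s. \<integral>\<^sup>+x. ennreal ((h (\<phi> s x))\<^sup>2) \<partial>M \<partial>measure_pmf p)"
  proof (rule nn_integral_pmf_swap)
    fix s assume "s \<in> set_pmf p"
    note meas[OF this, measurable]
    show "(\<lambda>x. ennreal ((h (\<phi> s x))\<^sup>2)) \<in> borel_measurable M" by measurable
  qed
  also have "\<dots> = (\<integral>\<^sup>+s. ennreal (\<integral>x. (h (\<phi> s x))\<^sup>2 \<partial>M) \<partial>measure_pmf p)"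
  proof (intro nn_integral_cong_AE, simp add: AE_measure_pmf_iff, intro ballI)
    fix s assume "s \<in> set_pmf p"
    note meas[OF this, measurable]
    have "integrable M (\<lambda>x. (h (\<phi> s x))\<^sup>2)"
      using sq by (intro integrable_const_bound[where B = "C\<^sup>2"]) auto
    then show "(\<integral>\<^sup>+x. ennreal ((h (\<phi> s x))\<^sup>2) \<partial>M) = ennreal (\<integral>x. (h (\<phi> s x))\<^sup>2 \<partial>M)"
      by (simp add: nn_integral_eq_integral)
  qed
  also have "\<dots> = ennreal (measure_pmf.expectation p (\<lambda>s. \<integral>x. (h (\<phi> s x))\<^sup>2 \<partial>M))"
  proof (intro nn_integral_eq_integral measure_pmf.integrable_const_bound[where B = "C\<^sup>2"])
    show "AE s in measure_pmf p. norm (\<integral>x. (h (\<phi> s x))\<^sup>2 \<partial>M) \<le> C\<^sup>2"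
    proof (simp add: AE_measure_pmf_iff, intro ballI)
      fix s assume "s \<in> set_pmf p"
      note meas[OF this, measurable]
      have "integrable M (\<lambda>x. (h (\<phi> s x))\<^sup>2)"
        using sq by (intro integrable_const_bound[where B = "C\<^sup>2"]) auto
      then have "(\<integral>x. (h (\<phi> s x))\<^sup>2 \<partial>M) \<le> (\<integral>x. C\<^sup>2 \<partial>M)"
        using sq by (intro integral_mono) auto
      then show "(\<integral>x. (h (\<phi> s x))\<^sup>2 \<partial>M) \<le> C\<^sup>2" by (simp add: prob_space)
    qed
  qed auto
  also have "\<dots> = ennreal (\<integral>x. (h x)\<^sup>2 \<partial>M)"
    using sq by (subst expectation_stationary[OF st p, of "\<lambda>x. (h x)\<^sup>2" "C\<^sup>2"]) auto
  also have "\<dots> = (\<integral>\<^sup>+x. ennreal ((h x)\<^sup>2) \<partial>M)"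
    using sq by (intro nn_integral_eq_integral[symmetric] integrable_const_bound[where B = "C\<^sup>2"]) auto
  finally have eq: "(\<integral>\<^sup>+x. D x \<partial>M) + (\<integral>\<^sup>+x. ennreal ((h x)\<^sup>2) \<partial>M) = (\<integral>\<^sup>+x. ennreal ((h x)\<^sup>2) \<partial>M)" .
  \<comment> \<open>The second moment of \<open>h\<close> is finite, so it may be cancelled from
    both sides of \<open>eq\<close>.\<close>
  have "(\<integral>\<^sup>+x. ennreal ((h x)\<^sup>2) \<partial>M) = ennreal (\<integral>x. (h x)\<^sup>2 \<partial>M)"
    using sq by (intro nn_integral_eq_integral integrable_const_bound[where B = "C\<^sup>2"]) auto
  then have "(\<integral>\<^sup>+x. D x \<partial>M) = 0"
    using eq by (metis add.commute add.right_neutral ennreal_add_left_cancel ennreal_neq_top infinity_ennreal_def)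
  then have "AE x in M. D x = 0"
    by (simp add: nn_integral_0_iff_AE)
  then show ?thesis
    by eventually_elim (auto simp: D_def nn_integral_0_iff_AE AE_measure_pmf_iff)
qed

text \<open>The translate by \<open>inv g\<close> appears because the image of \<open>B\<close>
  under \<open>\<phi> (inv g)\<close> is the preimage of \<open>B\<close> under
  \<open>\<phi> g\<close>.\<close>

lemma AE_invariant_set:
  assumes g: "g \<in> carrier G" and B: "B \<in> sets M"
    and null: "emeasure M (sym_diff B (\<phi> (inv g) ` B)) = 0"
  shows "AE x in M. \<phi> g x \<in> B \<longleftrightarrow> x \<in> B"
proof -
  have im: "\<phi> (inv g) ` B = \<phi> g -` B \<inter> space M"
    using act_image_eq_vimage[of "inv g" B] g sets.sets_into_space[OF B] group_G
    by (simp add: group.inv_closed group.inv_inv)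
  have "\<phi> g -` B \<inter> space M \<in> sets M"
    using action_measurable[OF g] B by (rule measurable_sets)
  then have "sym_diff B (\<phi> (inv g) ` B) \<in> null_sets M"
    using null B im by auto
  then show ?thesis
    by (rule AE_I') (auto simp: im)
qed

end

section \<open>Consequences of ergodicity and of the isometry of the Poisson transform\<close>

text \<open>A set cut out by a Borel condition on \<open>h\<close> is invariant up to null sets,
  hence null or conull. On a probability space \<open>h\<close> cannot lie strictly above its mean
  almost everywhere, nor strictly below it, so the two corresponding sets are null.\<close>

lemma (in ergodic_G_space) invariant_AE_const:
  fixes h :: "_ \<Rightarrow> real"
  assumes h[measurable]: "h \<in> borel_measurable M" and int: "integrable M h"
    and inv: "\<And>g. g \<in> carrier G \<Longrightarrow> AE x in M. h (\<phi> g x) = h x"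
  shows "AE x in M. h x = (\<integral>x. h x \<partial>M)"
proof -
  have zero_one: "(AE x in M. x \<notin> {x \<in> space M. P (h x)}) \<or> (AE x in M. P (h x))"
    if P[measurable]: "Measurable.pred borel P" for P :: "real \<Rightarrow> bool"
  proof -
    let ?B = "{x \<in> space M. P (h x)}"
    have B: "?B \<in> sets M" by measurable
    have "emeasure M (sym_diff ?B (\<phi> g ` ?B)) = 0" if g: "g \<in> carrier G" for g
    proof -
      have ig: "inv g \<in> carrier G" using g group_G by (simp add: group.inv_closed)
      have im: "\<phi> g ` ?B = \<phi> (inv g) -` ?B \<inter> space M"
        using act_image_eq_vimage[OF g, of ?B] by auto
      have m: "\<phi> (inv g) -` ?B \<inter> space M \<in> sets M"
        using action_measurable[OF ig] B by (rule measurable_sets)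
      have "AE x in M. x \<notin> sym_diff ?B (\<phi> g ` ?B)"
        using inv[OF ig] act_closed[OF ig] by (auto simp: im elim!: eventually_mono)
      then show ?thesis
        using B m im by (subst (asm) AE_iff_null_sets[symmetric]) auto
    qed
    from ergodic[OF B this] show ?thesis
    proof
      assume "emeasure M ?B = 0"
      then have "?B \<in> null_sets M" using B by auto
      then show ?thesis by (auto dest: AE_not_in)
    next
      assume "emeasure M (space M - ?B) = 0"
      then have "space M - ?B \<in> null_sets M" using B by auto
      then have "AE x in M. P (h x)" by (rule AE_I') auto
      then show ?thesis ..
    qed
  qed
  let ?c = "\<integral>x. h x \<partial>M"
  have "\<not> (AE x in M. ?c < h x)" "\<not> (AE x in M. h x < ?c)"
    using expectation_less[OF int, of ?c] expectation_greater[OF int, of ?c] by auto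
  then have "AE x in M. x \<notin> {x \<in> space M. ?c < h x}" "AE x in M. x \<notin> {x \<in> space M. h x < ?c}"
    using zero_one[of "\<lambda>t. ?c < t"] zero_one[of "\<lambda>t. t < ?c"] by auto
  then show ?thesis
    by (auto elim: AE_mp)
qed

text \<open>Constants have constant transform since \<open>m\<close> is a probability measure. By
  linearity \<open>f - c\<close> then has transform zero, and the isometry gives it norm
  zero.\<close>

lemma (in poisson_boundary) poisson_transform_const_imp_AE:
  assumes f: "f \<in> L_infinity m"
    and c: "\<And>s. s \<in> carrier G \<Longrightarrow> poisson_transform G m \<phi> f s = c"
  shows "AE z in m. f z = c"
proof -
  have one: "(\<lambda>_. 1) \<in> L_infinity m"
    by (auto simp: L_infinity_def intro!: exI[of _ 1])
  define d where "d z = f z - c" for z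
  have d: "d \<in> L_infinity m"
  proof -
    obtain C where "AE x in m. \<bar>f x\<bar> \<le> C" "f \<in> borel_measurable m"
      using f by (auto simp: L_infinity_def)
    moreover from this(1) have "AE x in m. \<bar>d x\<bar> \<le> C + \<bar>c\<bar>"
      by eventually_elim (auto simp: d_def)
    ultimately show ?thesis by (auto simp: L_infinity_def d_def[abs_def])
  qed
  have "poisson_transform G m \<phi> d s = 0" if s: "s \<in> carrier G" for s
    using transform_linear[OF f one s, of 1 "- c"] c[OF s] s
    by (simp add: d_def[abs_def] poisson_transform_def prob_space)
  then have "H_infinity_norm G (poisson_transform G m \<phi> d) = 0"
    using carrier_not_empty by (simp add: H_infinity_norm_def)
  then have norm: "L_infinity_norm m d = 0"
    using transform_isometric[OF d] by simp
  obtain C where C: "AE z in m. \<bar>d z\<bar> \<le> C" and [measurable]: "d \<in> borel_measurable m"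
    using d by (auto simp: L_infinity_def)
  let ?e = "esssup m (\<lambda>z. ereal \<bar>d z\<bar>)"
  \<comment> \<open>\<open>real_of_ereal\<close> sends both infinities to 0, so norm zero alone does
    not give \<open>?e = 0\<close>. The essential bound excludes one infinity and nonnegativity the
    other.\<close>
  have "?e \<le> ereal C"
    using C by (intro esssup_I) auto
  then have "?e \<noteq> \<infinity>" by auto
  moreover have "0 \<le> ?e"
    using esssup_mono[where M = m and f = "\<lambda>_. 0::ereal" and g = "\<lambda>z. ereal \<bar>d z\<bar>"] emeasure_space_1
    by (simp add: esssup_const)
  ultimately have "?e = 0"
    using norm by (cases ?e) (auto simp: L_infinity_norm_def zero_ereal_def)
  then have "AE z in m. ereal \<bar>d z\<bar> \<le> 0"
    using esssup_AE[where M = m and f = "\<lambda>z. ereal \<bar>d z\<bar>"] by simp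
  then show ?thesis
    by eventually_elim (simp add: d_def zero_ereal_def)
qed

section \<open>The diagonal action on a product\<close>

lemma group_action_diagonal_action:
  assumes "group_action G (space M) \<phi>" "group_action G (space N) \<psi>"
  shows "group_action G (space (M \<Otimes>\<^sub>M N)) (diagonal_action M N \<phi> \<psi>)"
proof -
  interpret M: group_action G "space M" \<phi> by fact
  interpret N: group_action G "space N" \<psi> by fact
  interpret group G by (rule M.group_G)
  let ?E = "space M \<times> space N" and ?\<delta> = "diagonal_action M N \<phi> \<psi>"
  have Bij: "?\<delta> g \<in> Bij ?E" if g: "g \<in> carrier G" for g
  proof -
    have "bij_betw (?\<delta> g) ?E ?E"
      by (rule bij_betw_byWitness[where f' = "?\<delta> (inv\<^bsub>G\<^esub> g)"])
        (use g in \<open>auto simp: diagonal_action_def M.act_closed N.act_closed M.act_inv_left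
          M.act_inv_right N.act_inv_left N.act_inv_right\<close>)
    then show ?thesis by (auto simp: Bij_def diagonal_action_def)
  qed
  have mult: "?\<delta> (g \<otimes>\<^bsub>G\<^esub> h) = compose ?E (?\<delta> g) (?\<delta> h)" if "g \<in> carrier G" "h \<in> carrier G" for g h
    using that by (auto simp: diagonal_action_def compose_def restrict_def fun_eq_iff
        M.composition_rule N.composition_rule M.act_closed N.act_closed)
  show ?thesis
    unfolding group_action_def group_hom_def group_hom_axioms_def space_pair_measure
  proof (intro conjI)
    show "?\<delta> \<in> hom G (BijGroup ?E)"
      using Bij mult by (auto simp: hom_def BijGroup_def)
  qed (use group_BijGroup is_group in auto)
qed

text \<open>Preservation of null sets is the main point: by Fubini it reduces to the two factors,
  one coordinate at a time.\<close>

lemma G_space_diagonal_action: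
  assumes "G_space G M \<phi>" "G_space G N \<psi>"
  shows "G_space G (M \<Otimes>\<^sub>M N) (diagonal_action M N \<phi> \<psi>)"
proof -
  interpret M: G_space G M \<phi> by fact
  interpret N: G_space G N \<psi> by fact
  interpret P: pair_prob_space M N ..
  let ?\<delta> = "diagonal_action M N \<phi> \<psi>"
  interpret D: group_action G "space (M \<Otimes>\<^sub>M N)" ?\<delta>
    by (rule group_action_diagonal_action) unfold_locales
  interpret group G by (rule M.group_G)
  have meas: "?\<delta> g \<in> measurable (M \<Otimes>\<^sub>M N) (M \<Otimes>\<^sub>M N)" if g: "g \<in> carrier G" for g
  proof -
    note M.action_measurable[OF g, measurable] N.action_measurable[OF g, measurable]
    have "(\<lambda>(x, y). (\<phi> g x, \<psi> g y)) \<in> measurable (M \<Otimes>\<^sub>M N) (M \<Otimes>\<^sub>M N)"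
      by measurable
    then show ?thesis
      by (subst measurable_cong) (auto simp: diagonal_action_def space_pair_measure)
  qed
  have null: "?\<delta> g -` B \<inter> space (M \<Otimes>\<^sub>M N) \<in> null_sets (M \<Otimes>\<^sub>M N)"
    if g: "g \<in> carrier G" and B: "B \<in> null_sets (M \<Otimes>\<^sub>M N)" for g B
  proof -
    note M.action_measurable[OF g, measurable] N.action_measurable[OF g, measurable]
    have [measurable]: "B \<in> sets (M \<Otimes>\<^sub>M N)" using B by auto
    \<comment> \<open>Almost every section of \<open>B\<close> is null. The action on
      \<open>N\<close> is applied inside each section, then the action on \<open>M\<close> to the
      resulting property of \<open>x\<close>.\<close>
    have "AE x in M. AE y in N. (x, y) \<notin> B"
      using P.AE_pair[OF AE_not_in[OF B]] .
    then have "AE x in M. AE y in N. (x, \<psi> g y) \<notin> B"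
      by eventually_elim (rule N.AE_act[OF g])
    then have "AE x in M. AE y in N. (\<phi> g x, \<psi> g y) \<notin> B"
      by (rule M.AE_act[OF g])
    then have "AE p in M \<Otimes>\<^sub>M N. (\<phi> g (fst p), \<psi> g (snd p)) \<notin> B"
      by (intro P.AE_pair_measure) auto
    then have "AE p in M \<Otimes>\<^sub>M N. p \<notin> ?\<delta> g -` B \<inter> space (M \<Otimes>\<^sub>M N)"
      by eventually_elim (auto simp: diagonal_action_def space_pair_measure)
    then show ?thesis
      using measurable_sets[OF meas[OF g], of B] by (subst AE_iff_null_sets) auto
  qed
  show ?thesis
  proof (intro G_space.intro G_space_axioms.intro)
    show "standard_borel (M \<Otimes>\<^sub>M N)"
      using M.standard_borel N.standard_borel by (rule standard_borel_pair_measure)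
    fix g B assume g: "g \<in> carrier G" and B: "B \<in> sets (M \<Otimes>\<^sub>M N)"
    have sub: "B \<subseteq> space (M \<Otimes>\<^sub>M N)" using B by (rule sets.sets_into_space)
    have im: "?\<delta> g ` B = ?\<delta> (inv\<^bsub>G\<^esub> g) -` B \<inter> space (M \<Otimes>\<^sub>M N)"
      by (rule D.act_image_eq_vimage[OF g sub])
    \<comment> \<open>By injectivity \<open>B\<close> is the preimage of its own translate, so
      \<open>null\<close> at \<open>g\<close> yields one direction of the equivalence and
      \<open>null\<close> at the inverse the other.\<close>
    have "?\<delta> g -` (?\<delta> g ` B) \<inter> space (M \<Otimes>\<^sub>M N) = B"
      using sub D.inj_prop[OF g] by (fastforce dest: inj_onD)
    then show "?\<delta> g ` B \<in> null_sets (M \<Otimes>\<^sub>M N) \<longleftrightarrow> B \<in> null_sets (M \<Otimes>\<^sub>M N)"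
      using null[OF g, of "?\<delta> g ` B"] null[OF inv_closed[OF g], of B] im by auto
  qed (use meas in \<open>auto intro: D.group_action_axioms P.prob_space_axioms\<close>)
qed

section \<open>The product of the Poisson boundary with an ergodic stationary space\<close>

theorem theorem3p1:
  fixes G :: "('g, 'c) monoid_scheme"
    and \<mu> :: "'g pmf"
    and m :: "'z measure" and \<phi> :: "'g \<Rightarrow> 'z \<Rightarrow> 'z"
    and \<nu> :: "'x measure" and \<psi> :: "'g \<Rightarrow> 'x \<Rightarrow> 'x"
  assumes "measured_group G \<mu>"
    and "poisson_boundary G \<mu> m \<phi>"
    and "ergodic_G_space G \<nu> \<psi>"
    and "stationary G (adjoint_pmf G \<mu>) \<nu> \<psi>"
  shows "ergodic_G_space G (m \<Otimes>\<^sub>M \<nu>) (diagonal_action m \<nu> \<phi> \<psi>)"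
proof -
  interpret Z: poisson_boundary G \<mu> m \<phi> by fact
  interpret X: ergodic_G_space G \<nu> \<psi> by fact
  interpret P: pair_prob_space m \<nu> ..
  let ?\<delta> = "diagonal_action m \<nu> \<phi> \<psi>"
  interpret D: G_space G "m \<Otimes>\<^sub>M \<nu>" ?\<delta>
    by (rule G_space_diagonal_action) unfold_locales
  have supp: "set_pmf (adjoint_pmf G \<mu>) \<subseteq> carrier G"
    using Z.set_pmf_subset by (auto simp: adjoint_pmf_def)
  show ?thesis
  proof (intro ergodic_G_space.intro ergodic_G_space_axioms.intro D.G_space_axioms)
    fix B assume B[measurable]: "B \<in> sets (m \<Otimes>\<^sub>M \<nu>)"
      and inv_B: "\<And>g. g \<in> carrier G \<Longrightarrow> emeasure (m \<Otimes>\<^sub>M \<nu>) (sym_diff B (?\<delta> g ` B)) = 0"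
    \<comment> \<open>The coordinates are swapped relative to \<open>B\<close>, so that
      \<open>F x\<close> is the indicator of the section over \<open>x\<close>.\<close>
    define F where "F x z = indicat_real B (z, x)" for x z
    define h where "h x = (\<integral>z. F x z \<partial>m)" for x
    have F[measurable]: "(\<lambda>(x, z). F x z) \<in> borel_measurable (\<nu> \<Otimes>\<^sub>M m)"
      unfolding F_def by measurable
    have F_section[measurable]: "F x \<in> borel_measurable m" if "x \<in> space \<nu>" for x
      using that F by simp
    have F_bound: "\<bar>F x z\<bar> \<le> 1" for x z
      by (simp add: F_def indicator_def)
    have h[measurable]: "h \<in> borel_measurable \<nu>"
      unfolding h_def by measurable
    have h_bound: "\<bar>h x\<bar> \<le> 1" for x
    proof -
      have "F x = indicator {z. (z, x) \<in> B}"
        by (auto simp: F_def indicator_def)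
      then show ?thesis by (simp add: h_def)
    qed

    \<comment> \<open>Invariance of \<open>B\<close> says that
      \<open>F (\<psi> g x) (\<phi> g z)\<close> equals \<open>F x z\<close> almost everywhere.
      Replacing \<open>x\<close> by its translate under the inverse of \<open>g\<close> and
      integrating over \<open>z\<close> gives the claim.\<close>
    have shift: "AE x in \<nu>. (\<integral>z. F x (\<phi> g z) \<partial>m) = h (\<psi> (inv\<^bsub>G\<^esub> g) x)" if g: "g \<in> carrier G" for g
    proof -
      have ig: "inv\<^bsub>G\<^esub> g \<in> carrier G" using g by simp
      note [measurable] = Z.action_measurable[OF g] X.action_measurable[OF g]
      have "AE p in m \<Otimes>\<^sub>M \<nu>. ?\<delta> g p \<in> B \<longleftrightarrow> p \<in> B"
        by (rule D.AE_invariant_set[OF g B inv_B[OF ig]])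
      then have "AE p in m \<Otimes>\<^sub>M \<nu>. (\<phi> g (fst p), \<psi> g (snd p)) \<in> B \<longleftrightarrow> (fst p, snd p) \<in> B"
        by (rule AE_mp) (auto simp: diagonal_action_def space_pair_measure)
      from P.AE_pair[OF this]
      have "AE z in m. AE x in \<nu>. (\<phi> g z, \<psi> g x) \<in> B \<longleftrightarrow> (z, x) \<in> B"
        by simp
      then have "AE x in \<nu>. AE z in m. (\<phi> g z, \<psi> g x) \<in> B \<longleftrightarrow> (z, x) \<in> B"
        by (subst P.AE_commute[symmetric]) auto
      then have "AE x in \<nu>. AE z in m. F (\<psi> g x) (\<phi> g z) = F x z"
        by (auto simp: F_def indicator_def elim!: eventually_mono)
      then have "AE x in \<nu>. AE z in m. F (\<psi> g (\<psi> (inv\<^bsub>G\<^esub> g) x)) (\<phi> g z) = F (\<psi> (inv\<^bsub>G\<^esub> g) x) z"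
        by (rule X.AE_act[OF ig])
      then show ?thesis
      proof (rule AE_mp, intro AE_I2 impI)
        fix x assume x: "x \<in> space \<nu>"
          and "AE z in m. F (\<psi> g (\<psi> (inv\<^bsub>G\<^esub> g) x)) (\<phi> g z) = F (\<psi> (inv\<^bsub>G\<^esub> g) x) z"
        then show "(\<integral>z. F x (\<phi> g z) \<partial>m) = h (\<psi> (inv\<^bsub>G\<^esub> g) x)"
          unfolding h_def using X.act_closed[OF ig x] Z.action_measurable[OF g] F_section
          by (intro integral_cong_AE) (auto simp: X.act_inv_right[OF g x])
      qed
    qed
    \<comment> \<open>Countability of the group provides one null set that serves all
      \<open>g\<close>.\<close>
    then have shift_all: "AE x in \<nu>. \<forall>g\<in>carrier G. (\<integral>z. F x (\<phi> g z) \<partial>m) = h (\<psi> (inv\<^bsub>G\<^esub> g) x)"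
      by (simp add: AE_ball_countable Z.countable_carrier)

    \<comment> \<open>The adjoint measure absorbs the inverse in \<open>shift_all\<close>: averaging
      \<open>h (\<psi> s x)\<close> over it averages the integrals of
      \<open>F x (\<phi> s z)\<close> over \<open>\<mu>\<close>, and stationarity of
      \<open>m\<close> evaluates that as \<open>h x\<close>.\<close>
    have "AE x in \<nu>. measure_pmf.expectation (adjoint_pmf G \<mu>) (\<lambda>s. h (\<psi> s x)) = h x"
      using shift_all
    proof (rule AE_mp, intro AE_I2 impI)
      fix x assume x: "x \<in> space \<nu>"
        and eq: "\<forall>g\<in>carrier G. (\<integral>z. F x (\<phi> g z) \<partial>m) = h (\<psi> (inv\<^bsub>G\<^esub> g) x)"
      have "measure_pmf.expectation (adjoint_pmf G \<mu>) (\<lambda>s. h (\<psi> s x))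
          = measure_pmf.expectation \<mu> (\<lambda>s. \<integral>z. F x (\<phi> s z) \<partial>m)"
        unfolding adjoint_pmf_def integral_map_pmf
        using eq Z.set_pmf_subset by (intro integral_cong_AE) (auto simp: AE_measure_pmf_iff)
      also have "\<dots> = h x"
        unfolding h_def
        by (rule Z.expectation_stationary[OF Z.boundary_stationary Z.set_pmf_subset F_section[OF x] F_bound])
      finally show "measure_pmf.expectation (adjoint_pmf G \<mu>) (\<lambda>s. h (\<psi> s x)) = h x" .
    qed
    from X.harmonic_imp_invariant[OF assms(4) supp h h_bound this]
    have h_supp: "AE x in \<nu>. h (\<psi> (inv\<^bsub>G\<^esub> s) x) = h x" if "s \<in> set_pmf \<mu>" for s
      using that by (auto simp: adjoint_pmf_def elim!: eventually_mono)
    \<comment> \<open>For a product \<open>s t\<close> the inverse acts first by the inverse of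
      \<open>s\<close>, then by that of \<open>t\<close>; the hypothesis for \<open>t\<close> is
      therefore used at the translated point.\<close>
    have "AE x in \<nu>. h (\<psi> (inv\<^bsub>G\<^esub> g) x) = h x" if "g \<in> semigroup_generate G (set_pmf \<mu>)" for g
      using that
    proof induction
      case (mult s t)
      then have s: "s \<in> carrier G" and t: "t \<in> carrier G"
        by (auto simp: Z.semigroup_generate_support)
      have "AE x in \<nu>. h (\<psi> (inv\<^bsub>G\<^esub> t) (\<psi> (inv\<^bsub>G\<^esub> s) x)) = h (\<psi> (inv\<^bsub>G\<^esub> s) x)"
        using s by (intro X.AE_act[OF _ mult.IH(2)]) simp
      with mult.IH(1) show ?case
        using s t by (auto simp: Z.inv_mult_group X.composition_rule elim!: AE_mp)
    qed (rule h_supp)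
    then have h_inv_inv: "AE x in \<nu>. h (\<psi> (inv\<^bsub>G\<^esub> g) x) = h x" if "g \<in> carrier G" for g
      using that by (simp add: Z.semigroup_generate_support)
    have h_inv: "AE x in \<nu>. h (\<psi> g x) = h x" if "g \<in> carrier G" for g
      using h_inv_inv[of "inv\<^bsub>G\<^esub> g"] that by simp
    have h_int: "integrable \<nu> h"
      using h_bound by (intro X.integrable_const_bound[where B = 1]) auto
    define c where "c = (\<integral>x. h x \<partial>\<nu>)"
    have h_const: "AE x in \<nu>. h x = c"
      unfolding c_def by (rule X.invariant_AE_const[OF h h_int h_inv])

    have "AE x in \<nu>. \<forall>g\<in>carrier G. h (\<psi> (inv\<^bsub>G\<^esub> g) x) = h x"
      by (simp add: AE_ball_countable Z.countable_carrier h_inv_inv)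
    with shift_all h_const
    have "AE x in \<nu>. \<forall>g\<in>carrier G. (\<integral>z. F x (\<phi> g z) \<partial>m) = c"
      by eventually_elim simp
    then have "AE x in \<nu>. AE z in m. F x z = c"
    proof (rule AE_mp, intro AE_I2[of \<nu>] impI)
      fix x assume "x \<in> space \<nu>" "\<forall>g\<in>carrier G. (\<integral>z. F x (\<phi> g z) \<partial>m) = c"
      then show "AE z in m. F x z = c"
        using F_section F_bound
        by (intro Z.poisson_transform_const_imp_AE)
          (auto simp: L_infinity_def poisson_transform_def intro!: exI[of _ 1])
    qed
    \<comment> \<open>The order of the variables is exchanged to match the factors of
      \<open>m \<Otimes>\<^sub>M \<nu>\<close>.\<close>
    then have "AE z in m. AE x in \<nu>. F x z = c"
      unfolding F_def by (subst P.AE_commute) auto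
    then have ae: "AE p in m \<Otimes>\<^sub>M \<nu>. indicat_real B p = c"
      unfolding F_def by (intro P.AE_pair_measure) auto
    show "emeasure (m \<Otimes>\<^sub>M \<nu>) B = 0 \<or> emeasure (m \<Otimes>\<^sub>M \<nu>) (space (m \<Otimes>\<^sub>M \<nu>) - B) = 0"
    \<comment> \<open>An indicator equal to \<open>c\<close> almost everywhere decides the
      alternative: for \<open>c = 1\<close> almost every point lies in \<open>B\<close>, otherwise
      almost none does.\<close>
    proof (cases "c = 1")
      case True
      then have "AE p in m \<Otimes>\<^sub>M \<nu>. p \<notin> space (m \<Otimes>\<^sub>M \<nu>) - B"
        using ae by (auto simp: indicator_def elim!: eventually_mono)
      then have "space (m \<Otimes>\<^sub>M \<nu>) - B \<in> null_sets (m \<Otimes>\<^sub>M \<nu>)"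
        by (subst AE_iff_null_sets) auto
      then show ?thesis by auto
    next
      case False
      then have "AE p in m \<Otimes>\<^sub>M \<nu>. p \<notin> B"
        using ae by (auto simp: indicator_def elim!: eventually_mono)
      then have "B \<in> null_sets (m \<Otimes>\<^sub>M \<nu>)"
        by (subst AE_iff_null_sets) auto
      then show ?thesis by auto
    qed
  qed
qed

end
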